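(* For every constant $\varepsilon>0$ there exist constants $\gamma,\alpha>0$ and $n_0$ such that for all $n\geq n_0$ the following holds. Let $k$ be an integer with $2 \leq k\leq (n/\log n)^{1/4}$, and let $\mathbf{c}=(c_1,\dots,c_k)$ be an initial $k$-color configuration on $n$ nodes with \[ \max\{c_j : j=1,\dots,k\}\leq \frac{n}{k}+\left(\frac{n}{k}\right)^{1-\varepsilon}. \] Run the 3-majority protocol from $\mathbf{C}^{(0)}=\mathbf{c}$ and let $\tau=\inf\{t\in\mathbb{N} : \mathbf{C}^{(t)}\text{ is monochromatic}\}$. Then $\tau\geq \gamma\, k\log n$ with probability at least $1-n^{-\alpha}$. (That is, $\tau=\Omega(k\log n)$ with high probability.)
   Context: A $k$-color configuration on $n$ nodes is a $k$-tuple $\mathbf{c}=(c_1,\dots,c_k)$ of non-negative integers with $\sum_{j} c_j = n$, where $c_j$ is the number of nodes with color $j\in[k]=\{1,\dots,k\}$. It is monochromatic if $c_j=n$ for some $j\in[k]$. 3-majority protocol (on the clique, synchronous rounds): at every round, every node, independently of the others, picks three nodes uniformly at random (including itself and with repetitions) and recolors itself according to the majority of the colors it sees; if it sees three different colors, it chooses the first one. All nodes update simultaneously, using the colors at the beginning of the round. $\mathbf{C}^{(t)}=(C^{(t)}_1,\dots,C^{(t)}_k)$ is the random configuration at round $t$. $\log$ is the natural logarithm. *)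

theory Defs
  imports "HOL-Probability.Probability"
begin

definition is_configuration :: "nat \<Rightarrow> nat \<Rightarrow> (nat \<Rightarrow> nat) \<Rightarrow> bool" where
  "is_configuration n k c \<longleftrightarrow> (\<Sum>j=1..k. c j) = n"

definition monochromatic :: "nat \<Rightarrow> nat \<Rightarrow> (nat \<Rightarrow> nat) \<Rightarrow> bool" where
  "monochromatic n k c \<longleftrightarrow> (\<exists>j\<in>{1..k}. c j = n)"

text \<open>
  The nodes are \<open>{..<n}\<close>. A coloring maps every node to its color; its values outside
  \<open>{..<n}\<close> are irrelevant.
\<close>

definition configuration_of :: "nat \<Rightarrow> (nat \<Rightarrow> nat) \<Rightarrow> nat \<Rightarrow> nat" where
  "configuration_of n x j = card {u \<in> {..<n}. x u = j}"

definition majority3 :: "'c \<Rightarrow> 'c \<Rightarrow> 'c \<Rightarrow> 'c" where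
  "majority3 a b c =
     (if a = b \<or> a = c then a
      else if b = c then b
      else a)"

text \<open>
  The random choices of one round: every node in \<open>{..<n}\<close> independently draws an ordered triple
  of nodes, uniformly at random and with repetitions allowed. (Outside \<open>{..<n}\<close> the drawn
  function has the dummy value \<open>(0, 0, 0)\<close>.)
\<close>

definition picks_pmf :: "nat \<Rightarrow> (nat \<Rightarrow> nat \<times> nat \<times> nat) pmf" where
  "picks_pmf n = Pi_pmf {..<n} (0, 0, 0) (\<lambda>_. pmf_of_set ({..<n} \<times> {..<n} \<times> {..<n}))"

definition majority_round :: "(nat \<Rightarrow> nat \<times> nat \<times> nat) \<Rightarrow> (nat \<Rightarrow> nat) \<Rightarrow> nat \<Rightarrow> nat" where
  "majority_round p x u = (case p u of (v1, v2, v3) \<Rightarrow> majority3 (x v1) (x v2) (x v3))"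

text \<open>
  The probability space of the protocol is the space of infinite sequences of independent
  rounds of choices; given these choices, the run is deterministic.
\<close>

definition protocol_space :: "nat \<Rightarrow> (nat \<Rightarrow> nat \<times> nat \<times> nat) stream measure" where
  "protocol_space n = stream_space (measure_pmf (picks_pmf n))"

primrec coloring_at :: "(nat \<Rightarrow> nat) \<Rightarrow> (nat \<Rightarrow> nat \<times> nat \<times> nat) stream \<Rightarrow> nat \<Rightarrow> nat \<Rightarrow> nat" where
  "coloring_at x \<omega> 0 = x"
| "coloring_at x \<omega> (Suc t) = majority_round (\<omega> !! t) (coloring_at x \<omega> t)"

definition configuration_at ::
  "nat \<Rightarrow> (nat \<Rightarrow> nat) \<Rightarrow> (nat \<Rightarrow> nat \<times> nat \<times> nat) stream \<Rightarrow> nat \<Rightarrow> nat \<Rightarrow> nat" where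
  "configuration_at n x \<omega> t = configuration_of n (coloring_at x \<omega> t)"

text \<open>
  The infimum is taken in \<^typ>\<open>enat\<close>, so the value is \<open>\<infinity>\<close> if the run never
  becomes monochromatic.
\<close>

definition consensus_time ::
  "nat \<Rightarrow> nat \<Rightarrow> (nat \<Rightarrow> nat) \<Rightarrow> (nat \<Rightarrow> nat \<times> nat \<times> nat) stream \<Rightarrow> enat" where
  "consensus_time n k x \<omega> = Inf (enat ` {t. monochromatic n k (configuration_at n x \<omega> t)})"

end

theory Submission
  imports Defs "HOL-Real_Asymp.Real_Asymp"
begin

text \<open>
  If \<open>c\<^sub>j\<close> nodes have color \<open>j\<close>, the expected number after one round is
  \<open>c\<^sub>j (1 + c\<^sub>j / n - S)\<close> with \<open>S = (\<Sum>h. (c\<^sub>h / n)\<^sup>2) \<ge> 1 / k\<close> by Cauchy-Schwarz. So if all colors have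
  at most \<open>n / k + B\<close> nodes with \<open>B \<le> n / k\<close>, every expectation is at most
  \<open>n / k + (1 + 2 / k) B\<close>, and a Chernoff bound shows that all colors have at most
  \<open>n / k + (1 + 3 / k) B\<close> nodes after the round, except with probability
  \<open>k exp (- B\<^sup>2 / (12 n k))\<close>. Starting with \<open>B = (n / k) n powr (- \<beta>)\<close>, which is large enough for this to be
  polynomially small, the excess is multiplied by at most \<open>n powr (3 \<gamma>)\<close> during \<open>\<gamma> k log n\<close> rounds
  and thus stays below \<open>n / (2 k)\<close> if \<open>3 \<gamma> < \<beta>\<close>.
\<close>

section \<open>Chernoff bound for a count of independent events\<close>

text \<open>Exponential moment method: the moment of the count factorizes over the independent
  coordinates, and \<open>exp s - 1 <= s + s^2\<close> on [0, 1] bounds each factor. Only an upper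
  bound \<open>m\<close> on the mean enters, and \<open>s\<close> stays free so that it can be
  optimized later.\<close>

lemma Pi_pmf_count_chernoff:
  fixes p :: "'a \<Rightarrow> 'b pmf" and s m a q :: real
  assumes A: "finite A" and q: "\<And>u. u \<in> A \<Longrightarrow> measure_pmf.prob (p u) (E u) \<le> q"
    and m: "real (card A) * q \<le> m" and s: "0 \<le> s" "s \<le> 1"
  shows "measure_pmf.prob (Pi_pmf A d p) {f. m + a \<le> real (card {u\<in>A. f u \<in> E u})}
           \<le> exp (m * s\<^sup>2 - s * a)"
proof -
  let ?M = "measure_pmf (Pi_pmf A d p)"
  define g where "g u y = exp (s * indicator (E u) y)" for u y
  define F where "F f = (\<Prod>u\<in>A. g u (f u))" for f
  have g_bounds: "0 \<le> g u y" "g u y \<le> exp s" for u y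
    using s by (auto simp: g_def indicator_def)
  have F_eq: "F f = exp (s * real (card {u\<in>A. f u \<in> E u}))" for f
    using A by (simp add: F_def g_def exp_sum[symmetric] sum_distrib_left[symmetric]
        indicator_def sum.If_cases Int_def)
  have int_g: "integrable (measure_pmf (p u)) (g u)" for u
    by (rule measure_pmf.integrable_const_bound[where B = "exp s"]) (use g_bounds in auto)
  have F_nonneg: "0 \<le> F f" for f
    by (simp add: F_eq)
  have int_F: "integrable ?M F"
  proof (rule measure_pmf.integrable_const_bound[where B = "exp s ^ card A"])
    have "F f \<le> exp s ^ card A" for f
      unfolding F_def using prod_mono[of A "\<lambda>u. g u (f u)" "\<lambda>_. exp s"] g_bounds by simp
    then show "AE f in ?M. norm (F f) \<le> exp s ^ card A"
      using F_nonneg by simp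
  qed auto
  have exp_s: "exp s - 1 \<le> s + s\<^sup>2" "0 \<le> exp s - 1"
    using exp_bound[OF s] s by auto
  have one: "measure_pmf.expectation (p u) (g u) \<le> exp (q * (s + s\<^sup>2))" if "u \<in> A" for u
  proof -
    have "g u y = 1 + (exp s - 1) * indicator (E u) y" for y
      by (auto simp: g_def indicator_def)
    then have "measure_pmf.expectation (p u) (g u) =
        measure_pmf.expectation (p u) (\<lambda>y. 1 + (exp s - 1) * indicator (E u) y)"
      by presburger
    also have "\<dots> = 1 + (exp s - 1) * measure_pmf.prob (p u) (E u)"
      by (subst Bochner_Integration.integral_add)
        (auto intro!: integrable_mult_right simp: measure_pmf.integrable_const_bound[where B = 1])
    also have "\<dots> \<le> 1 + (s + s\<^sup>2) * q"
      using exp_s q[OF that] by (intro add_left_mono mult_mono) auto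
    also have "\<dots> \<le> exp (q * (s + s\<^sup>2))"
      using exp_ge_add_one_self[of "q * (s + s\<^sup>2)"] by (simp add: mult.commute)
    finally show ?thesis .
  qed
  have "measure_pmf.expectation (Pi_pmf A d p) F = (\<Prod>u\<in>A. measure_pmf.expectation (p u) (g u))"
    unfolding F_def by (rule expectation_prod_Pi_pmf) (use A int_g g_bounds in auto)
  also have "\<dots> \<le> (\<Prod>u\<in>A. exp (q * (s + s\<^sup>2)))"
    using one g_bounds by (intro prod_mono) (auto intro!: integral_nonneg_AE)
  also have "\<dots> = exp (real (card A) * q * (s + s\<^sup>2))"
    by (simp add: exp_of_nat_mult[symmetric] mult.assoc)
  also have "\<dots> \<le> exp (m * (s + s\<^sup>2))"
    using m s by (simp add: mult_right_mono)
  finally have EF: "measure_pmf.expectation (Pi_pmf A d p) F \<le> exp (m * (s + s\<^sup>2))" .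
  \<comment> \<open>Markov's inequality for \<open>F\<close>, whose values are the exponentials of
    \<open>s\<close> times the count.\<close>
  have "{f. m + a \<le> real (card {u\<in>A. f u \<in> E u})} \<subseteq> {f \<in> space ?M. F f \<ge> exp (s * (m + a))}"
    using s by (auto simp: F_eq intro: mult_left_mono)
  then have "measure_pmf.prob (Pi_pmf A d p) {f. m + a \<le> real (card {u\<in>A. f u \<in> E u})} \<le>
      measure_pmf.prob (Pi_pmf A d p) {f \<in> space ?M. F f \<ge> exp (s * (m + a))}"
    by (intro measure_pmf.finite_measure_mono) auto
  also have "\<dots> \<le> measure_pmf.expectation (Pi_pmf A d p) F / exp (s * (m + a))"
    by (rule integral_Markov_inequality_measure[where A = "{}"]) (use int_F F_nonneg in auto)
  also have "\<dots> \<le> exp (m * (s + s\<^sup>2)) / exp (s * (m + a))"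
    using EF by (simp add: divide_right_mono)
  also have "\<dots> = exp (m * s\<^sup>2 - s * a)"
    by (simp add: exp_diff[symmetric] algebra_simps)
  finally show ?thesis .
qed

section \<open>Expected color counts after one round\<close>

lemma configuration_of_eq_sum: "real (configuration_of n x j) = (\<Sum>u<n. of_bool (x u = j))"
  by (simp add: configuration_of_def of_bool_def sum.If_cases Int_def)

text \<open>The double sum equals the sum of the squared color counts. The counts of the
  \<open>k\<close> colors add up to \<open>n\<close>, so Cauchy-Schwarz applies.\<close>

lemma card_equal_colored_pairs_ge:
  assumes "x \<in> {..<n} \<rightarrow> {1..k}"
  shows "(real n)\<^sup>2 \<le> (\<Sum>v<n. \<Sum>w<n. of_bool (x v = x w)) * real k"
proof -
  have "(\<Sum>h=1..k. real (configuration_of n x h)) = (\<Sum>u<n. \<Sum>h=1..k. of_bool (x u = h))"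
    unfolding configuration_of_eq_sum by (rule sum.swap)
  also have "\<dots> = (\<Sum>u<n. 1)"
    using assms by (intro sum.cong refl) (auto simp: of_bool_def)
  finally have n: "(\<Sum>h=1..k. real (configuration_of n x h)) = real n"
    by simp
  have "(\<Sum>h=1..k. (real (configuration_of n x h))\<^sup>2) =
      (\<Sum>h=1..k. \<Sum>v<n. \<Sum>w<n. of_bool (x v = h) * of_bool (x w = h))"
    unfolding configuration_of_eq_sum power2_eq_square sum_product ..
  also have "\<dots> = (\<Sum>v<n. \<Sum>w<n. \<Sum>h=1..k. of_bool (x v = h) * of_bool (x w = h))"
    by (simp only: sum.swap[of _ "{..<n}" "{1..k}"])
  also have "\<dots> = (\<Sum>v<n. \<Sum>w<n. of_bool (x v = x w))"
  proof (intro sum.cong refl)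
    fix v w assume "v \<in> {..<n}" "w \<in> {..<n}"
    then have "x v \<in> {1..k}"
      using assms by auto
    moreover have "(\<Sum>h=1..k. of_bool (x v = h) * of_bool (x w = h) :: real) =
        (\<Sum>h=1..k. if h = x v then of_bool (x v = x w) else 0)"
      by (intro sum.cong) auto
    ultimately show "(\<Sum>h=1..k. of_bool (x v = h) * of_bool (x w = h)) = (of_bool (x v = x w) :: real)"
      by simp
  qed
  finally show ?thesis
    using sum_squared_le_sum_of_squares[of "\<lambda>h. real (configuration_of n x h)" "{1..k}"] n by simp
qed

text \<open>
  A triple \<open>(a, b, c)\<close> yields \<open>j\<close> iff \<open>a = j\<close>, except that \<open>b = c\<close> overrides \<open>a\<close>; hence
  \<open>[majority3 a b c = j] = [a = j] - [a = j] [b = c] + [b = j] [c = j]\<close>.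
\<close>

lemma prob_majority3_le:
  assumes x: "x \<in> {..<n} \<rightarrow> {1..k}" and n: "0 < n" and k: "0 < k"
  shows "real n * measure_pmf.prob (pmf_of_set ({..<n} \<times> {..<n} \<times> {..<n}))
             {(v1, v2, v3). majority3 (x v1) (x v2) (x v3) = j}
          \<le> real (configuration_of n x j) * (1 - 1 / real k + real (configuration_of n x j) / real n)"
proof -
  let ?S = "{..<n} \<times> {..<n} \<times> {..<n}"
  let ?E = "{(v1, v2, v3). majority3 (x v1) (x v2) (x v3) = j}"
  define c where "c = real (configuration_of n x j)"
  \<comment> \<open>\<open>Q / n^2\<close> is the probability that two independent uniform nodes
    agree in color; it is the \<open>S\<close> of the overview.\<close>
  define Q :: real where "Q = (\<Sum>v<n. \<Sum>w<n. of_bool (x v = x w))"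
  have ind: "of_bool (majority3 (x a) (x b) (x d) = j) =
      (of_bool (x a = j) - of_bool (x a = j) * of_bool (x b = x d)
       + of_bool (x b = j) * of_bool (x d = j) :: real)" for a b d
    by (auto simp: majority3_def of_bool_def)
  have "real (card (?S \<inter> ?E)) = (\<Sum>t\<in>?S. of_bool (t \<in> ?E))"
    by (simp add: of_bool_def sum.If_cases Int_def)
  also have "\<dots> = (\<Sum>a<n. \<Sum>b<n. \<Sum>d<n. of_bool (majority3 (x a) (x b) (x d) = j))"
    unfolding sum.cartesian_product by (intro sum.cong) auto
  also have "\<dots> = (\<Sum>a<n. \<Sum>b<n. \<Sum>d<n. of_bool (x a = j))
      - (\<Sum>a<n. \<Sum>b<n. \<Sum>d<n. of_bool (x a = j) * of_bool (x b = x d))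
      + (\<Sum>a<n. \<Sum>b<n. \<Sum>d<n. of_bool (x b = j) * of_bool (x d = j))"
    unfolding ind by (simp add: sum.distrib sum_subtractf)
  also have "\<dots> = c * (real n)\<^sup>2 - c * Q + real n * c\<^sup>2"
    unfolding c_def Q_def configuration_of_eq_sum power2_eq_square
    by (simp add: sum_distrib_left[symmetric] sum_distrib_right[symmetric] algebra_simps)
  finally have "real n * measure_pmf.prob (pmf_of_set ?S) ?E =
      (c * (real n)\<^sup>2 - c * Q + real n * c\<^sup>2) / (real n)\<^sup>2"
    using n by (subst measure_pmf_of_set) (auto simp: power2_eq_square)
  also have "\<dots> = c * (1 - Q / (real n)\<^sup>2 + c / real n)"
    using n by (simp add: field_simps power2_eq_square)
  also have "\<dots> \<le> c * (1 - 1 / real k + c / real n)"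
  proof (rule mult_left_mono)
    have "(real n)\<^sup>2 \<le> Q * real k"
      unfolding Q_def using card_equal_colored_pairs_ge[OF x] .
    then have "1 / real k \<le> Q / (real n)\<^sup>2"
      using n k by (simp add: field_simps)
    then show "1 - Q / (real n)\<^sup>2 + c / real n \<le> 1 - 1 / real k + c / real n"
      by simp
  qed (simp add: c_def)
  finally show ?thesis
    unfolding c_def .
qed

text \<open>\<open>B\<close> is the allowed excess over the average. The range of the colors is
  included because it makes the counts sum to \<open>n\<close>, as Cauchy-Schwarz requires, and it
  has to be carried from round to round.\<close>

definition balanced :: "nat \<Rightarrow> nat \<Rightarrow> real \<Rightarrow> (nat \<Rightarrow> nat) \<Rightarrow> bool" where
  "balanced n k B x \<longleftrightarrow> x \<in> {..<n} \<rightarrow> {1..k} \<and>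
     (\<forall>j\<in>{1..k}. real (configuration_of n x j) \<le> real n / real k + B)"

lemma mean_color_count_le:
  assumes bal: "balanced n k B x" and j: "j \<in> {1..k}" and n: "0 < n" and k: "0 < k"
    and B: "0 \<le> B" "B \<le> real n / real k"
  shows "real n * measure_pmf.prob (pmf_of_set ({..<n} \<times> {..<n} \<times> {..<n}))
             {(v1, v2, v3). majority3 (x v1) (x v2) (x v3) = j}
          \<le> real n / real k + (1 + 2 / real k) * B"
proof -
  define c where "c = real (configuration_of n x j)"
  have x: "x \<in> {..<n} \<rightarrow> {1..k}" and c: "c \<le> real n / real k + B" "0 \<le> c"
    using bal j by (auto simp: balanced_def c_def)
  \<comment> \<open>Both factors increase with \<open>c\<close> and \<open>1 - 1 / k\<close> is
    nonnegative, so \<open>c\<close> may be replaced by its upper bound. Then \<open>- 1 / k\<close>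
    cancels against the average, leaving the factor \<open>1 + B / n\<close>.\<close>
  have "c * (1 - 1 / real k + c / real n)
      \<le> (real n / real k + B) * (1 - 1 / real k + (real n / real k + B) / real n)"
    using c k B by (intro mult_mono add_left_mono divide_right_mono add_nonneg_nonneg) auto
  also have "\<dots> = real n / real k + (1 + 1 / real k) * B + B * (B / real n)"
    using n k by (simp add: field_simps)
  also have "\<dots> \<le> real n / real k + (1 + 1 / real k) * B + B * (1 / real k)"
    using B n k by (intro add_left_mono mult_left_mono) (auto simp: field_simps)
  also have "\<dots> = real n / real k + (1 + 2 / real k) * B"
    by (simp add: field_simps)
  finally show ?thesis
    using prob_majority3_le[OF x n k, of j] unfolding c_def by linarith
qed

section \<open>Concentration in one round\<close>

text \<open>The majority is always one of the colors seen. Picks must come from the support, since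
  \<open>x\<close> is unconstrained outside the nodes.\<close>

lemma majority_round_in_colors:
  assumes x: "x \<in> {..<n} \<rightarrow> {1..k}" and n: "0 < n" and p: "p \<in> set_pmf (picks_pmf n)"
  shows "majority_round p x \<in> {..<n} \<rightarrow> {1..k}"
proof
  fix u assume "u \<in> {..<n}"
  then have "p u \<in> {..<n} \<times> {..<n} \<times> {..<n}"
    using p n by (auto simp: picks_pmf_def set_Pi_pmf PiE_dflt_def set_pmf_of_set lessThan_empty_iff)
  then have "x (fst (p u)) \<in> {1..k}" "x (fst (snd (p u))) \<in> {1..k}" "x (snd (snd (p u))) \<in> {1..k}"
    using x by (auto simp: Pi_def)
  then show "majority_round p x u \<in> {1..k}"
    by (auto simp: majority_round_def majority3_def split: prod.split)
qed

text \<open>The mean allows the factor \<open>1 + 2 / k\<close> on the excess and the threshold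
  \<open>1 + 3 / k\<close>, so the Chernoff bound has slack \<open>B / k\<close>.\<close>

lemma prob_color_count_gt_le:
  assumes bal: "balanced n k B x" and j: "j \<in> {1..k}" and n: "0 < n" and k: "2 \<le> k"
    and B: "0 \<le> B" "B \<le> real n / real k"
  shows "measure_pmf.prob (picks_pmf n)
           {p. real n / real k + B * (1 + 3 / real k) < real (configuration_of n (majority_round p x) j)}
          \<le> exp (- (B\<^sup>2 / (12 * real n * real k)))"
proof -
  define m where "m = real n / real k + (1 + 2 / real k) * B"
  \<comment> \<open>This \<open>s\<close> minimizes \<open>3 * (n / k) * s^2 - s * B / k\<close>,
    the exponent after bounding \<open>m\<close> by \<open>3 * n / k\<close>.\<close>
  define s where "s = B / (6 * real n)"
  let ?E = "{(v1, v2, v3). majority3 (x v1) (x v2) (x v3) = j}"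
  have s: "0 \<le> s" "s \<le> 1"
  proof -
    have "B \<le> real n"
      using B(2) k by (rule_tac order_trans[OF B(2)]) (simp add: divide_le_eq mult_le_cancel_left1)
    then show "0 \<le> s" "s \<le> 1"
      using B n by (auto simp: s_def)
  qed
  have count: "configuration_of n (majority_round p x) j = card {u\<in>{..<n}. p u \<in> ?E}" for p
    unfolding configuration_of_def by (intro arg_cong[where f = card] Collect_cong)
      (auto simp: majority_round_def split: prod.splits)
  have "measure_pmf.prob (picks_pmf n)
           {p. real n / real k + B * (1 + 3 / real k) < real (configuration_of n (majority_round p x) j)}
      \<le> measure_pmf.prob (picks_pmf n) {p. m + B / real k \<le> real (card {u\<in>{..<n}. p u \<in> ?E})}"
    by (intro measure_pmf.finite_measure_mono) (auto simp: count m_def algebra_simps)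
  also have "\<dots> \<le> exp (m * s\<^sup>2 - s * (B / real k))"
    unfolding picks_pmf_def
    by (rule Pi_pmf_count_chernoff[where q =
          "measure_pmf.prob (pmf_of_set ({..<n} \<times> {..<n} \<times> {..<n})) ?E"])
      (use mean_color_count_le[OF bal j n _ B] k s in \<open>auto simp: m_def\<close>)
  also have "\<dots> \<le> exp (- (B\<^sup>2 / (12 * real n * real k)))"
  proof -
    \<comment> \<open>Here \<open>k >= 2\<close> gives \<open>1 + 2 / k <= 2\<close>.\<close>
    have "(1 + 2 / real k) * B \<le> 2 * (real n / real k)"
      using B k by (intro mult_mono) (auto simp: field_simps)
    then have "m \<le> 3 * (real n / real k)"
      unfolding m_def by linarith
    then have "m * s\<^sup>2 - s * (B / real k) \<le> 3 * (real n / real k) * s\<^sup>2 - s * (B / real k)"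
      by (intro diff_right_mono mult_right_mono) auto
    also have "\<dots> = - (B\<^sup>2 / (12 * real n * real k))"
      using n k unfolding s_def by (simp add: field_simps power2_eq_square)
    finally show ?thesis
      by simp
  qed
  finally show ?thesis .
qed

text \<open>Union bound over the \<open>k\<close> colors; the new colors lie in the range almost
  surely, so only a count that is too large can break balance.\<close>

lemma prob_not_balanced_round_le:
  assumes bal: "balanced n k B x" and n: "0 < n" and k: "2 \<le> k"
    and B: "0 \<le> B" "B \<le> real n / real k"
  shows "measure_pmf.prob (picks_pmf n) {p. \<not> balanced n k (B * (1 + 3 / real k)) (majority_round p x)}
          \<le> real k * exp (- (B\<^sup>2 / (12 * real n * real k)))"
proof -
  let ?F = "\<lambda>j. {p. real n / real k + B * (1 + 3 / real k)
      < real (configuration_of n (majority_round p x) j)}"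
  have x: "x \<in> {..<n} \<rightarrow> {1..k}"
    using bal by (simp add: balanced_def)
  have "measure_pmf.prob (picks_pmf n) {p. \<not> balanced n k (B * (1 + 3 / real k)) (majority_round p x)}
      \<le> measure_pmf.prob (picks_pmf n) (\<Union>j\<in>{1..k}. ?F j)"
    using majority_round_in_colors[OF x n]
    by (intro measure_pmf.finite_measure_mono_AE) (auto simp: balanced_def AE_measure_pmf_iff not_le)
  also have "\<dots> \<le> (\<Sum>j\<in>{1..k}. measure_pmf.prob (picks_pmf n) (?F j))"
    by (intro measure_pmf.finite_measure_subadditive_finite) auto
  also have "\<dots> \<le> (\<Sum>j\<in>{1..k}. exp (- (B\<^sup>2 / (12 * real n * real k))))"
    using prob_color_count_gt_le[OF bal _ n k B] by (intro sum_mono) auto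
  finally show ?thesis
    by simp
qed

section \<open>Measurability of the run\<close>

lemma measurable_majority3 [measurable (raw)]:
  fixes f g h :: "'a \<Rightarrow> 'c::countable"
  assumes f: "f \<in> measurable M (count_space UNIV)" and g: "g \<in> measurable M (count_space UNIV)"
    and h: "h \<in> measurable M (count_space UNIV)"
  shows "(\<lambda>\<omega>. majority3 (f \<omega>) (g \<omega>) (h \<omega>)) \<in> measurable M (count_space UNIV)"
  by (rule measurable_compose_countable[OF measurable_compose_countable[OF
        measurable_compose[OF h] g] f]) simp

text \<open>The triple drawn by \<open>u\<close> takes countably many values, and for each fixed
  triple the three colors are measurable by induction. The node is generalized because the triple
  points to other nodes.\<close>

lemma measurable_coloring_at [measurable]:
  "(\<lambda>\<omega>. coloring_at x \<omega> t u) \<in> measurable (protocol_space n) (count_space UNIV)"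
proof (induction t arbitrary: u)
  case 0
  then show ?case by simp
next
  case (Suc t)
  note [measurable] = Suc.IH
  have "(\<lambda>\<omega>. \<omega> !! t) \<in> measurable (protocol_space n) (measure_pmf (picks_pmf n))"
    unfolding protocol_space_def by (rule measurable_snth)
  then have snth: "(\<lambda>\<omega>. (\<omega> !! t) u) \<in> measurable (protocol_space n) (count_space UNIV)"
    by (rule measurable_compose) simp
  have "(\<lambda>\<omega>. (\<lambda>(v1, v2, v3). \<lambda>\<omega>. majority3 (coloring_at x \<omega> t v1) (coloring_at x \<omega> t v2)
      (coloring_at x \<omega> t v3)) ((\<omega> !! t) u) \<omega>) \<in> measurable (protocol_space n) (count_space UNIV)"
    by (rule measurable_compose_countable[OF _ snth]) (auto split: prod.split)
  then show ?case
    by (simp add: majority_round_def split_def)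
qed

lemma measurable_configuration_at [measurable]:
  "(\<lambda>\<omega>. real (configuration_of n' (coloring_at x \<omega> t) j)) \<in> borel_measurable (protocol_space n)"
  unfolding configuration_of_eq_sum by measurable

lemma measurable_balanced [measurable]:
  "Measurable.pred (protocol_space n) (\<lambda>\<omega>. balanced n' k B (coloring_at x \<omega> t))"
proof -
  have [measurable]: "Measurable.pred (protocol_space n) (\<lambda>\<omega>. coloring_at x \<omega> t u \<in> {1..k})" for u
    by (rule measurable_compose[OF measurable_coloring_at]) simp
  have eq: "balanced n' k B (coloring_at x \<omega> t) \<longleftrightarrow> (\<forall>u\<in>{..<n'}. coloring_at x \<omega> t u \<in> {1..k}) \<and>
      (\<forall>j\<in>{1..k}. real (configuration_of n' (coloring_at x \<omega> t) j) \<le> real n' / real k + B)" for \<omega>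
    by (auto simp: balanced_def Pi_def)
  show ?thesis
    unfolding eq by measurable
qed

section \<open>Iteration over the rounds\<close>

text \<open>The recursion peels off the last round, whereas the stream measure splits at the first;
  this converts one into the other.\<close>

lemma coloring_at_SCons: "coloring_at x (p ## \<omega>) (Suc t) = coloring_at (majority_round p x) \<omega> t"
  by (induction t) auto

text \<open>Induction on \<open>T\<close>: after the first round the run restarts from a new
  coloring with a larger excess, hence the generalization over \<open>B\<close> and
  \<open>x\<close>. Larger excesses make failure less likely, so the bound for the fixed
  \<open>B0\<close> serves every round. The bound on the final excess keeps each round within the
  range of the one-round estimate.\<close>

lemma prob_ever_unbalanced_le:
  assumes n: "0 < n" and k: "2 \<le> k" and B0: "0 \<le> B0"
    and "B0 \<le> B" and "B * (1 + 3 / real k) ^ T \<le> real n / real k" and "balanced n k B x"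
  shows "emeasure (protocol_space n) {\<omega> \<in> space (protocol_space n).
            \<exists>t\<le>T. \<not> balanced n k (B * (1 + 3 / real k) ^ t) (coloring_at x \<omega> t)}
         \<le> ennreal (real T * (real k * exp (- (B0\<^sup>2 / (12 * real n * real k)))))"
  using assms(4-)
proof (induction T arbitrary: B x)
  case 0
  then show ?case by (simp add: emeasure_eq_0)
next
  case (Suc T)
  define r where "r = 1 + 3 / real k"
  define q where "q = real k * exp (- (B0\<^sup>2 / (12 * real n * real k)))"
  define bad where "bad T B x = {\<omega> \<in> space (protocol_space n).
      \<exists>t\<le>T. \<not> balanced n k (B * r ^ t) (coloring_at x \<omega> t)}" for T B x
  have [measurable]: "bad T B x \<in> sets (protocol_space n)" for T B x
    unfolding bad_def by measurable
  have r: "1 \<le> r"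
    by (simp add: r_def)
  have q: "0 \<le> q"
    by (simp add: q_def)
  have BT: "B * r ^ Suc T \<le> real n / real k"
    using Suc.prems by (simp add: r_def)
  have "B * 1 \<le> B * r ^ Suc T" "B * 1 \<le> B * r"
    using r Suc.prems B0 by (intro mult_left_mono one_le_power; simp)+
  then have B: "0 \<le> B" "B \<le> real n / real k" "B0 \<le> B * r"
    using BT B0 Suc.prems by auto
  interpret prob_space "protocol_space n"
    unfolding protocol_space_def by (rule prob_space.prob_space_stream_space[OF prob_space_measure_pmf])
  let ?N = "{p. \<not> balanced n k (B * r) (majority_round p x)}"
  \<comment> \<open>Time 0 cannot fail because \<open>x\<close> is balanced, so every failure
    happens in the run that starts after the head \<open>p\<close>.\<close>
  have slice: "{\<omega> \<in> space (protocol_space n). p ## \<omega> \<in> bad (Suc T) B x} =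
      bad T (B * r) (majority_round p x)" for p
  proof -
    have "(\<exists>t\<le>Suc T. \<not> balanced n k (B * r ^ t) (coloring_at x (p ## \<omega>) t)) \<longleftrightarrow>
        (\<exists>t\<le>T. \<not> balanced n k (B * r * r ^ t) (coloring_at (majority_round p x) \<omega> t))" for \<omega>
    proof -
      have "(\<exists>t\<le>Suc T. \<not> balanced n k (B * r ^ t) (coloring_at x (p ## \<omega>) t)) \<longleftrightarrow>
        (\<exists>t\<le>T. \<not> balanced n k (B * r ^ Suc t) (coloring_at x (p ## \<omega>) (Suc t)))"
        using Suc.prems(3)
        by (metis Suc_le_mono coloring_at.simps(1) mult.right_neutral not0_implies_Suc power_0)
      then show ?thesis
        unfolding coloring_at_SCons by (simp add: mult.assoc)
    qed
    then show ?thesis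
      by (auto simp: bad_def protocol_space_def space_stream_space streams_UNIV)
  qed
  have "emeasure (protocol_space n) (bad (Suc T) B x) =
      (\<integral>\<^sup>+p. emeasure (protocol_space n) (bad T (B * r) (majority_round p x)) \<partial>picks_pmf n)"
    unfolding slice[symmetric] unfolding protocol_space_def
    by (rule prob_space.emeasure_stream_space[OF prob_space_measure_pmf]) (simp flip: protocol_space_def)
  \<comment> \<open>If the first round breaks balance, the failure probability is bounded by 1;
    otherwise the induction hypothesis applies.\<close>
  also have "\<dots> \<le> (\<integral>\<^sup>+p. indicator ?N p + ennreal (real T * q) \<partial>picks_pmf n)"
  proof (rule nn_integral_mono)
    fix p
    show "emeasure (protocol_space n) (bad T (B * r) (majority_round p x))
        \<le> indicator ?N p + ennreal (real T * q)"
    proof (cases "p \<in> ?N")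
      case True
      then show ?thesis
        using emeasure_le_1[of "bad T (B * r) (majority_round p x)"]
        by (auto intro: order_trans add_increasing2)
    next
      case False
      then have "emeasure (protocol_space n) (bad T (B * r) (majority_round p x)) \<le> ennreal (real T * q)"
        unfolding bad_def q_def r_def
        by (intro Suc.IH) (use B BT in \<open>auto simp: r_def mult.assoc\<close>)
      then show ?thesis
        using False by simp
    qed
  qed
  also have "\<dots> = emeasure (picks_pmf n) ?N + ennreal (real T * q)"
    by (simp add: nn_integral_add measure_pmf.emeasure_space_1)
  also have "emeasure (picks_pmf n) ?N \<le> ennreal q"
  proof -
    have "measure_pmf.prob (picks_pmf n) ?N \<le> real k * exp (- (B\<^sup>2 / (12 * real n * real k)))"
      unfolding r_def by (rule prob_not_balanced_round_le) (use Suc.prems n k B in auto)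
    also have "\<dots> \<le> q"
      unfolding q_def using Suc.prems B0 n k
      by (intro mult_left_mono) (auto intro!: divide_right_mono power_mono)
    finally show ?thesis
      by (simp add: measure_pmf.emeasure_eq_measure ennreal_leI)
  qed
  also have "ennreal q + ennreal (real T * q) = ennreal (real (Suc T) * q)"
    using q by (simp add: ennreal_plus[symmetric] algebra_simps del: ennreal_plus)
  finally show ?case
    unfolding bad_def q_def r_def by (simp add: add_right_mono)
qed

section \<open>From balance to a late consensus time\<close>

text \<open>A nonempty set of times attains its infimum by well-ordering, and the empty set gives
  infinity. The right-hand side is a countable conjunction over times, which yields measurability of
  the event.\<close>

lemma consensus_time_ge_iff:
  "r \<le> ereal_of_enat (consensus_time n k x \<omega>) \<longleftrightarrow>
     (\<forall>t. monochromatic n k (configuration_at n x \<omega> t) \<longrightarrow> r \<le> ereal (real t))"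
proof -
  let ?A = "enat ` {t. monochromatic n k (configuration_at n x \<omega> t)}"
  show ?thesis
  proof
    assume r: "r \<le> ereal_of_enat (consensus_time n k x \<omega>)"
    show "\<forall>t. monochromatic n k (configuration_at n x \<omega> t) \<longrightarrow> r \<le> ereal (real t)"
    proof (intro allI impI)
      fix t assume "monochromatic n k (configuration_at n x \<omega> t)"
      then have "consensus_time n k x \<omega> \<le> enat t"
        unfolding consensus_time_def by (intro Inf_lower) auto
      then have "ereal_of_enat (consensus_time n k x \<omega>) \<le> ereal_of_enat (enat t)"
        by (simp only: ereal_of_enat_le_iff)
      then show "r \<le> ereal (real t)"
        using r by simp
    qed
  next
    assume r: "\<forall>t. monochromatic n k (configuration_at n x \<omega> t) \<longrightarrow> r \<le> ereal (real t)"
    show "r \<le> ereal_of_enat (consensus_time n k x \<omega>)"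
    proof (cases "?A = {}")
      case True
      then show ?thesis
        by (simp add: consensus_time_def Inf_enat_def)
    next
      case False
      then have "consensus_time n k x \<omega> \<in> ?A"
        unfolding consensus_time_def by (auto intro: wellorder_InfI)
      then show ?thesis
        using r by auto
    qed
  qed
qed

text \<open>While balance lasts with excess below \<open>n / (2 * k)\<close>, every count is below
  \<open>3 * n / (2 * k)\<close>, which is less than \<open>n\<close> since \<open>k >= 2\<close>.
  So no run outside \<open>bad\<close> is monochromatic up to time \<open>T\<close>.\<close>

lemma prob_consensus_time_ge:
  assumes n: "0 < n" and k: "2 \<le> k" and B: "0 \<le> B"
    and bal: "balanced n k B x" and T: "B * (1 + 3 / real k) ^ T < real n / 2 / real k"
    and r: "r < real (Suc T)"
  shows "1 - real T * (real k * exp (- (B\<^sup>2 / (12 * real n * real k))))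
           \<le> measure (protocol_space n) {\<omega> \<in> space (protocol_space n).
                ereal r \<le> ereal_of_enat (consensus_time n k x \<omega>)}"
proof -
  let ?M = "protocol_space n"
  let ?q = "real T * (real k * exp (- (B\<^sup>2 / (12 * real n * real k))))"
  define bad where "bad = {\<omega> \<in> space ?M.
      \<exists>t\<le>T. \<not> balanced n k (B * (1 + 3 / real k) ^ t) (coloring_at x \<omega> t)}"
  define late where "late = {\<omega> \<in> space ?M. ereal r \<le> ereal_of_enat (consensus_time n k x \<omega>)}"
  interpret prob_space ?M
    unfolding protocol_space_def by (rule prob_space.prob_space_stream_space[OF prob_space_measure_pmf])
  have bad_sets: "bad \<in> sets ?M"
    unfolding bad_def by measurable
  have late_sets: "late \<in> sets ?M"
  proof -
    have "late = {\<omega> \<in> space ?M. \<forall>t. (\<exists>j\<in>{1..k}. real (configuration_of n (coloring_at x \<omega> t) j) = real n)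
        \<longrightarrow> r \<le> real t}"
      by (simp add: late_def consensus_time_ge_iff monochromatic_def configuration_at_def)
    also have "\<dots> \<in> sets ?M"
      by measurable
    finally show ?thesis .
  qed
  have "space ?M - bad \<subseteq> late"
  proof
    fix \<omega> assume \<omega>: "\<omega> \<in> space ?M - bad"
    have "r \<le> real t" if mono: "monochromatic n k (configuration_at n x \<omega> t)" for t
    proof (rule ccontr)
      assume "\<not> r \<le> real t"
      \<comment> \<open>An integer time below \<open>r < T + 1\<close> is at most
        \<open>T\<close>.\<close>
      then have t: "t \<le> T"
        using r by linarith
      then have "balanced n k (B * (1 + 3 / real k) ^ t) (coloring_at x \<omega> t)"
        using \<omega> by (auto simp: bad_def)
      then have "real n \<le> real n / real k + B * (1 + 3 / real k) ^ t"
        using mono by (auto simp: balanced_def monochromatic_def configuration_at_def)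
      also have "\<dots> \<le> real n / real k + B * (1 + 3 / real k) ^ T"
        using t B by (intro add_left_mono mult_left_mono power_increasing) auto
      also have "\<dots> < real n / real k + real n / 2 / real k"
        using T by simp
      also have "\<dots> \<le> real n"
        using k n by (simp add: field_simps)
      finally show False
        by simp
    qed
    then show "\<omega> \<in> late"
      using \<omega> by (simp add: late_def consensus_time_ge_iff)
  qed
  then have "prob (space ?M - bad) \<le> prob late"
    using late_sets by (rule finite_measure_mono)
  moreover have "prob bad \<le> ?q"
  proof -
    have "real n / 2 / real k \<le> real n / real k"
      by (intro divide_right_mono) auto
    then have "emeasure ?M bad \<le> ennreal ?q"
      unfolding bad_def using T B n k bal by (intro prob_ever_unbalanced_le) auto
    then show ?thesis
      by (simp add: emeasure_eq_measure)
  qed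
  ultimately show ?thesis
    using prob_compl[OF bad_sets] unfolding late_def by linarith
qed

section \<open>Choice of constants and conclusion\<close>

theorem theorem4p2:
  fixes \<epsilon> :: real
  assumes "\<epsilon> > 0"
  shows "\<exists>\<gamma>>0. \<exists>\<alpha>>0. \<exists>n0::nat. \<forall>n\<ge>n0. \<forall>(k::nat) (c::nat \<Rightarrow> nat) (x::nat \<Rightarrow> nat).
           2 \<le> k \<longrightarrow>
           real k \<le> (real n / ln (real n)) powr (1/4) \<longrightarrow>
           is_configuration n k c \<longrightarrow>
           real (Max {c j |j. j \<in> {1..k}})
             \<le> real n / real k + (real n / real k) powr (1 - \<epsilon>) \<longrightarrow>
           x \<in> {..<n} \<rightarrow> {1..k} \<longrightarrow>
           (\<forall>j\<in>{1..k}. configuration_of n x j = c j) \<longrightarrow>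
           measure (protocol_space n)
             {\<omega> \<in> space (protocol_space n).
                ereal_of_enat (consensus_time n k x \<omega>) \<ge> ereal (\<gamma> * real k * ln (real n))}
             \<ge> 1 - real n powr (- \<alpha>)"
proof -
  \<comment> \<open>The bound \<open>3 * \<epsilon> / 4\<close> makes the initial excess fit into
    \<open>B\<close>, because \<open>n / k\<close> is at least n to the 3/4. The bound
    \<open>1 / 16\<close> gives \<open>7 / 8 <= 1 - 2 * \<beta>\<close>, used for the lower bound on
    \<open>B^2\<close>.\<close>
  define \<beta> where "\<beta> = min (3 * \<epsilon> / 4) (1 / 16)"
  \<comment> \<open>The excess grows at most by n to the \<open>3 * \<gamma> = \<beta> / 2\<close>,
    half of the exponent gained in \<open>B\<close>.\<close>
  define \<gamma> where "\<gamma> = \<beta> / 6"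
  have \<beta>: "0 < \<beta>" "\<beta> \<le> 3 * \<epsilon> / 4" "\<beta> \<le> 1 / 16"
    using assms by (auto simp: \<beta>_def)
  have "eventually (\<lambda>n::nat. 1 \<le> ln (real n) \<and> ln (real n) \<le> real n powr (1/2)
      \<and> 24 * ln (real n) \<le> real n powr (1/8)) sequentially"
    by (intro eventually_conj; real_asymp)
  moreover have "eventually (\<lambda>n::nat. real n powr (- (\<beta> / 2)) < 1 / 2) sequentially"
  proof (rule order_tendstoD)
    show "((\<lambda>n. real n powr (- (\<beta> / 2))) \<longlongrightarrow> 0) sequentially"
      using \<beta> by (intro tendsto_neg_powr filterlim_real_sequentially) auto
  qed simp
  ultimately have "eventually (\<lambda>n::nat. 1 \<le> ln (real n) \<and> ln (real n) \<le> real n powr (1/2)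
      \<and> 24 * ln (real n) \<le> real n powr (1/8) \<and> real n powr (- (\<beta> / 2)) < 1 / 2) sequentially"
    by eventually_elim auto
  then obtain n0 where n0: "\<And>n. n0 \<le> n \<Longrightarrow> 1 \<le> ln (real n) \<and> ln (real n) \<le> real n powr (1/2)
      \<and> 24 * ln (real n) \<le> real n powr (1/8) \<and> real n powr (- (\<beta> / 2)) < 1 / 2"
    unfolding eventually_sequentially by blast
  have main: "1 - real n powr (- 1) \<le> measure (protocol_space n) {\<omega> \<in> space (protocol_space n).
      ereal (\<gamma> * real k * ln (real n)) \<le> ereal_of_enat (consensus_time n k x \<omega>)}"
    if "max 1 n0 \<le> n" and k: "2 \<le> k" and kn: "real k \<le> (real n / ln (real n)) powr (1/4)"
      and Max: "real (Max {c j |j. j \<in> {1..k}}) \<le> real n / real k + (real n / real k) powr (1 - \<epsilon>)"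
      and x: "x \<in> {..<n} \<rightarrow> {1..k}" and c: "\<forall>j\<in>{1..k}. configuration_of n x j = c j"
    for n k :: nat and c x :: "nat \<Rightarrow> nat"
  proof -
    define L where "L = ln (real n)"
    define T where "T = nat \<lfloor>\<gamma> * real k * L\<rfloor>"
    define B where "B = real n / real k * real n powr (- \<beta>)"
    have n: "1 \<le> real n" "0 < n"
      and L: "1 \<le> L" "L \<le> real n powr (1/2)" "24 * L \<le> real n powr (1/8)"
      and half: "real n powr (- (\<beta> / 2)) < 1 / 2"
      using that(1) n0[of n] by (auto simp: L_def)
    have n_powr: "real n powr a = exp (a * L)" for a
      using n by (simp add: powr_def L_def)
    have k_le: "real k \<le> real n powr (1/4)"
    proof -
      have "(real n / L) powr (1/4) \<le> real n powr (1/4)"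
        using n L by (intro powr_mono2) (auto simp: field_simps)
      then show ?thesis
        using kn unfolding L_def by linarith
    qed
    have nk: "real n powr (3/4) \<le> real n / real k"
    proof -
      have "real n powr (3/4) * real k \<le> real n powr (3/4) * real n powr (1/4)"
        using k_le by (rule mult_left_mono) simp
      also have "\<dots> = real n"
        using n by (simp add: powr_add[symmetric])
      finally show ?thesis
        using k by (simp add: field_simps)
    qed
    have B: "0 \<le> B"
      by (simp add: B_def)
    have "(real n / real k) powr (1 - \<epsilon>) \<le> B"
    proof -
      \<comment> \<open>The exponent is negative, so the lower bound on \<open>n / k\<close> becomes
        an upper bound on the power.\<close>
      have "(real n / real k) powr (- \<epsilon>) \<le> (real n powr (3/4)) powr (- \<epsilon>)"
        using nk n assms by (intro powr_mono2') auto
      also have "\<dots> \<le> real n powr (- \<beta>)"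
        using n \<beta> by (simp add: powr_powr powr_mono)
      finally have "real n / real k * (real n / real k) powr (- \<epsilon>) \<le> B"
        unfolding B_def by (rule mult_left_mono) simp
      then show ?thesis
        using n k by (simp add: powr_diff powr_minus divide_inverse)
    qed
    moreover have "c j \<le> Max {c j |j. j \<in> {1..k}}" if "j \<in> {1..k}" for j
      using that by (intro Max_ge) auto
    ultimately have "real (c j) \<le> real n / real k + B" if "j \<in> {1..k}" for j
      using Max that by (smt (verit) of_nat_mono)
    then have bal: "balanced n k B x"
      using x c by (simp add: balanced_def)
    have \<gamma>kL: "0 \<le> \<gamma> * real k * L"
      using \<beta> L by (simp add: \<gamma>_def)
    have T: "real T \<le> \<gamma> * real k * L" "\<gamma> * real k * L < real (Suc T)"
      using \<gamma>kL unfolding T_def by linarith+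
    \<comment> \<open>With \<open>1 + y <= exp y\<close>, the factor \<open>k\<close> in
      \<open>T\<close> cancels against \<open>3 / k\<close>.\<close>
    have "(1 + 3 / real k) ^ T \<le> exp (3 / real k) ^ T"
      using exp_ge_add_one_self[of "3 / real k"] by (intro power_mono) auto
    also have "\<dots> = exp (real T * (3 / real k))"
      by (rule exp_of_nat_mult[symmetric])
    also have "\<dots> \<le> exp (\<gamma> * real k * L * (3 / real k))"
      using mult_right_mono[OF T(1), of "3 / real k"] by simp
    also have "\<dots> = real n powr (\<beta> / 2)"
      using k by (simp add: n_powr \<gamma>_def)
    finally have "B * (1 + 3 / real k) ^ T \<le> B * real n powr (\<beta> / 2)"
      using B by (rule mult_left_mono)
    also have "\<dots> = real n / real k * real n powr (- (\<beta> / 2))"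
      unfolding B_def by (simp add: powr_add[symmetric])
    also have "\<dots> < real n / real k * (1 / 2)"
      using half n k by (intro mult_strict_left_mono) auto
    finally have BT: "B * (1 + 3 / real k) ^ T < real n / 2 / real k"
      by simp
    \<comment> \<open>After clearing denominators this is
      \<open>24 * L * k^3 <= n powr (1 - 2 * \<beta>)\<close>: \<open>k^3\<close> costs exponent 3/4
      and the logarithm 1/8. It makes the tail for one color and one round at most 1 / n^2.\<close>
    have "24 * real n * real k * L \<le> B\<^sup>2"
    proof -
      have "24 * L * real k ^ 3 \<le> real n powr (1/8) * (real n powr (1/4)) ^ 3"
        using L k_le by (intro mult_mono power_mono) auto
      also have "\<dots> = real n powr (7/8)"
        using n by (simp add: powr_power powr_add[symmetric])
      also have "\<dots> \<le> real n powr (1 - 2 * \<beta>)"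
        using n \<beta> by (intro powr_mono) auto
      also have "\<dots> = real n * (real n powr (- \<beta>))\<^sup>2"
        using n by (simp add: powr_diff powr_minus powr_power field_simps)
      finally have "24 * L * real k ^ 3 * (real n / (real k)\<^sup>2)
          \<le> real n * (real n powr (- \<beta>))\<^sup>2 * (real n / (real k)\<^sup>2)"
        by (rule mult_right_mono) simp
      then show ?thesis
        using n k unfolding B_def by (simp add: field_simps power2_eq_square power3_eq_cube)
    qed
    then have "2 * L \<le> B\<^sup>2 / (12 * real n * real k)"
      using n k by (simp add: field_simps)
    then have "exp (- (B\<^sup>2 / (12 * real n * real k))) \<le> real n powr (- 2)"
      by (simp add: n_powr)
    \<comment> \<open>The union bound has \<open>T * k\<close> terms. Two factors \<open>k\<close>
      and one \<open>L\<close> give exponent 1/4 + 1/4 + 1/2 = 1, so the total failure probability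
      is at most 1 / n and the witness for \<open>\<alpha>\<close> is 1.\<close>
    moreover have "real T * real k \<le> real n powr 1"
    proof -
      have "real T * real k \<le> (1 * real k * L) * real k"
        using T \<beta> L by (intro mult_right_mono order_trans[OF T(1)]) (auto simp: \<gamma>_def)
      also have "\<dots> \<le> (1 * real n powr (1/4) * real n powr (1/2)) * real n powr (1/4)"
        using k_le L by (intro mult_mono) auto
      also have "\<dots> = real n powr 1"
        by (simp only: mult_1 powr_add[symmetric]) simp
      finally show ?thesis .
    qed
    ultimately have "real T * real k * exp (- (B\<^sup>2 / (12 * real n * real k)))
        \<le> real n powr 1 * real n powr (- 2)"
      by (intro mult_mono) auto
    also have "\<dots> = real n powr (- 1)"
      by (simp only: powr_add[symmetric]) simp
    finally show ?thesis
      using prob_consensus_time_ge[OF n(2) k B bal BT T(2)] unfolding L_def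
      by (simp add: mult.assoc)
  qed
  have "0 < \<gamma>"
    using \<beta> by (simp add: \<gamma>_def)
  with main show ?thesis
    by (intro exI[of _ \<gamma>] exI[of _ "1::real"] conjI exI[of _ "max 1 n0"] allI impI) auto
qed

end
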